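(* Let $\beta\ge 0$, $B>0$ and $\epsilon\in(0,1/5)$. There is a constant $C>0$ depending only on $\epsilon,\beta,B,h$ and $D$ such that, for every graph $G$ as in the context with maximum degree $D$ and lattice spacing $h$ and with $n>C$ vertices, $$\frac{\log Z}{n}-F(\beta,B)\ \ge\ -Cn^{-1/5}-C(nh^2)^{-1},$$ and $$\frac{\log Z}{n}-F(\beta,B)\ \le\ \begin{cases} Cn^{-1/5+\epsilon}+Cn^{-4\epsilon/5} & \text{if } \beta B^2\le\theta_c,\\ Cn^{-1/5+\epsilon} & \text{if } \beta B^2>\theta_c.\end{cases}$$
   Context: Let $G=(V,E)$ be a finite undirected graph without self-loops, $n=|V|$, $D$ its maximum degree, and $h>0$ a real number. For $f=(f_x)_{x\in V}\in\mathbb{C}^V$ let $N(f)=\sum_{x\in V}|f_x|^2$ and $$H(f)=\frac{2}{n}\sum_{(x,y)\in E}\Big|\frac{f_x-f_y}{h}\Big|^2-\frac1n\sum_{x\in V}|f_x|^4,$$ where the first sum runs over the edges of $G$, each counted once. Let $df=\prod_{x}df_x$ be Lebesgue measure on $\mathbb{C}^V\cong\mathbb{R}^{2n}$, and $Z=Z(\beta,B)=\int_{\mathbb{C}^V}e^{-\beta H(f)}\mathbf 1_{\{N(f)\le Bn\}}\,df$. For $\theta\ge 2$ let $$m(\theta)=\frac{\theta}{2}-\frac12+\frac{\theta}{2}\sqrt{1-\frac2\theta}+\log\Big(\frac12-\frac12\sqrt{1-\frac2\theta}\Big);$$ $m$ is strictly increasing on $[2,\infty)$ with $m(2)<0<m(3)$,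 and $\theta_c$ denotes its unique zero ($\theta_c\approx 2.455407$). Define $F(\beta,B)=\log(B\pi e)$ if $\beta B^2\le\theta_c$ and $F(\beta,B)=\log(B\pi e)+m(\beta B^2)$ if $\beta B^2>\theta_c$. *)

theory Defs
  imports "HOL-Analysis.Analysis"
begin

definition simple_graph :: "nat \<Rightarrow> (nat \<Rightarrow> nat \<Rightarrow> bool) \<Rightarrow> bool" where
  "simple_graph n E \<longleftrightarrow> (\<forall>x y. E x y \<longrightarrow> x < n \<and> y < n \<and> x \<noteq> y \<and> E y x)"

definition degree :: "nat \<Rightarrow> (nat \<Rightarrow> nat \<Rightarrow> bool) \<Rightarrow> nat \<Rightarrow> nat" where
  "degree n E x = card {y. y < n \<and> E x y}"

definition max_degree :: "nat \<Rightarrow> (nat \<Rightarrow> nat \<Rightarrow> bool) \<Rightarrow> nat" where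
  "max_degree n E = Max (degree n E ` {..<n})"

definition edges :: "nat \<Rightarrow> (nat \<Rightarrow> nat \<Rightarrow> bool) \<Rightarrow> (nat \<times> nat) set" where
  "edges n E = {(x, y). x < n \<and> y < n \<and> x < y \<and> E x y}"

definition Nmass :: "nat \<Rightarrow> (nat \<Rightarrow> complex) \<Rightarrow> real" where
  "Nmass n f = (\<Sum>x<n. (cmod (f x))\<^sup>2)"

definition Ham :: "nat \<Rightarrow> (nat \<Rightarrow> nat \<Rightarrow> bool) \<Rightarrow> real \<Rightarrow> (nat \<Rightarrow> complex) \<Rightarrow> real" where
  "Ham n E h f =
     2 / real n * (\<Sum>(x, y)\<in>edges n E. (cmod ((f x - f y) / complex_of_real h))\<^sup>2)
     - 1 / real n * (\<Sum>x<n. (cmod (f x)) ^ 4)"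

definition LebV :: "nat \<Rightarrow> (nat \<Rightarrow> complex) measure" where
  "LebV n = PiM {..<n} (\<lambda>_. (lborel :: complex measure))"

definition Zpart :: "nat \<Rightarrow> (nat \<Rightarrow> nat \<Rightarrow> bool) \<Rightarrow> real \<Rightarrow> real \<Rightarrow> real \<Rightarrow> real" where
  "Zpart n E h \<beta> B =
     (LINT f | LebV n. exp (- \<beta> * Ham n E h f) * indicator {f. Nmass n f \<le> B * real n} f)"

definition m_fun :: "real \<Rightarrow> real" where
  "m_fun \<theta> = \<theta> / 2 - 1 / 2 + \<theta> / 2 * sqrt (1 - 2 / \<theta>)
              + ln (1 / 2 - 1 / 2 * sqrt (1 - 2 / \<theta>))"

definition theta_c :: real where
  "theta_c = (THE \<theta>. \<theta> \<ge> 2 \<and> m_fun \<theta> = 0)"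

definition Ffree :: "real \<Rightarrow> real \<Rightarrow> real" where
  "Ffree \<beta> B = (if \<beta> * B\<^sup>2 \<le> theta_c then ln (B * pi * exp 1)
                 else ln (B * pi * exp 1) + m_fun (\<beta> * B\<^sup>2))"

end

theory Submission
  imports Defs
begin

text \<open>
  Since the constant may depend on \<open>h\<close> and \<open>D\<close>, the kinetic term contributes only \<open>O(1)\<close> to
  \<open>ln Z\<close>, and the graph plays no further role. What remains is the integral of
  \<open>exp (\<beta> / n * \<Sum> \<bar>f x\<bar>^4)\<close> over the ball of squared radius \<open>B n\<close>. A site carrying the fraction \<open>a\<close>
  of the mass has energy contribution \<open>n \<theta> a\<^sup>2\<close> with \<open>\<theta> = \<beta> B\<^sup>2\<close>, at the price of a factor
  \<open>(1 - a)^n\<close> in the volume left to the others; \<open>m_fun \<theta>\<close> is the value of \<open>\<theta> a\<^sup>2 + ln (1 - a)\<close> at its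
  outer critical point, and the global maximum on \<open>[0, 1)\<close> is \<open>0\<close> or \<open>m_fun \<theta>\<close>.
  For the upper bound, take \<open>k\<close> of order \<open>\<surd>n\<close>: some set \<open>A\<close> of \<open>k\<close> sites contains all sites of mass above
  \<open>B n / k\<close>, so the other sites contribute at most \<open>\<theta> n / k\<close> to the exponent, and the sum over
  the choices of \<open>A\<close> costs only \<open>O(k ln n)\<close>. The total error is of order \<open>ln n / \<surd>n\<close>.
\<close>

section \<open>The energy-entropy balance\<close>

definition phi :: "real \<Rightarrow> real \<Rightarrow> real" where
  "phi \<theta> a = \<theta> * a\<^sup>2 + ln (1 - a)"

text \<open>The larger root of \<open>2 * \<theta> * a * (1 - a) = 1\<close>, the equation for
  critical points of \<open>phi \<theta>\<close>; the other root is
  \<open>1 - outer_crit \<theta>\<close>.\<close>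

definition outer_crit :: "real \<Rightarrow> real" where
  "outer_crit \<theta> = (1 + sqrt (1 - 2 / \<theta>)) / 2"

lemma outer_crit_bounds:
  assumes "\<theta> \<ge> 2"
  shows "1 / 2 \<le> outer_crit \<theta>" "outer_crit \<theta> < 1"
  using assms by (auto simp: outer_crit_def real_less_lsqrt field_simps)

lemma outer_crit_root:
  assumes "\<theta> \<ge> 2"
  shows "2 * \<theta> * outer_crit \<theta> * (1 - outer_crit \<theta>) = 1"
proof -
  have "(sqrt (1 - 2 / \<theta>))\<^sup>2 = 1 - 2 / \<theta>" using assms by simp
  then have "4 * (outer_crit \<theta> * (1 - outer_crit \<theta>)) = 2 / \<theta>"
    unfolding outer_crit_def by (simp add: field_simps power2_eq_square)
  then show ?thesis using assms by (simp add: field_simps)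
qed

text \<open>The critical equation turns \<open>\<theta> * c\<^sup>2\<close> into
  \<open>\<theta> * c - 1 / 2\<close> for \<open>c = outer_crit \<theta>\<close>, which accounts for
  the linear shape of \<open>m_fun\<close> outside its logarithm.\<close>

lemma m_fun_eq_phi:
  assumes "\<theta> \<ge> 2"
  shows "m_fun \<theta> = phi \<theta> (outer_crit \<theta>)"
proof -
  have "\<theta> * (outer_crit \<theta>)\<^sup>2 = \<theta> * outer_crit \<theta> - 1 / 2"
    using outer_crit_root[OF assms] by (simp add: algebra_simps power2_eq_square)
  moreover have "1 - outer_crit \<theta> = 1 / 2 - 1 / 2 * sqrt (1 - 2 / \<theta>)"
    by (simp add: outer_crit_def field_simps)
  ultimately show ?thesis
    by (simp add: m_fun_def phi_def) (simp add: outer_crit_def algebra_simps add_divide_distrib)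
qed

lemma has_derivative_phi:
  assumes "a < 1"
  shows "(phi \<theta> has_real_derivative (2 * \<theta> * a * (1 - a) - 1) / (1 - a)) (at a)"
  unfolding phi_def[abs_def] using assms
  by (auto intro!: derivative_eq_intros simp: field_simps)

text \<open>With both roots visible, the sign of the derivative can be read off: on
  \<open>[0, 1)\<close>, \<open>phi \<theta>\<close> falls up to \<open>1 - c\<close>, rises up to
  \<open>c\<close> and falls again, where \<open>c = outer_crit \<theta>\<close>.\<close>

lemma phi_deriv_factor:
  assumes "\<theta> \<ge> 2"
  shows "2 * \<theta> * a * (1 - a) - 1 = 2 * \<theta> * (outer_crit \<theta> - a) * (a - (1 - outer_crit \<theta>))"
proof -
  have "2 * \<theta> * (outer_crit \<theta> - a) * (a - (1 - outer_crit \<theta>))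
      = 2 * \<theta> * a * (1 - a) - 2 * \<theta> * outer_crit \<theta> * (1 - outer_crit \<theta>)"
    by (simp add: algebra_simps)
  then show ?thesis using outer_crit_root[OF assms] by simp
qed

text \<open>Since \<open>1 - c \<le> 1 / 2\<close>, the derivative changes sign on
  \<open>[1/2, 1)\<close> only at \<open>c\<close>, from plus to minus.\<close>

lemma phi_le_m_fun:
  assumes th: "\<theta> \<ge> 2" and a: "1 / 2 \<le> a" "a < 1"
  shows "phi \<theta> a \<le> m_fun \<theta>"
proof -
  define c where "c = outer_crit \<theta>"
  have c: "1 / 2 \<le> c" "c < 1" using outer_crit_bounds[OF th] by (auto simp: c_def)
  have "phi \<theta> a \<le> phi \<theta> c"
  proof (cases "a \<le> c")
    case True
    show ?thesis
    proof (rule DERIV_nonneg_imp_nondecreasing[OF True])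
      fix x assume x: "a \<le> x" "x \<le> c"
      then have "(2 * \<theta> * x * (1 - x) - 1) / (1 - x) \<ge> 0"
        using a c th unfolding phi_deriv_factor[OF th] c_def[symmetric]
        by (intro divide_nonneg_nonneg mult_nonneg_nonneg) auto
      then show "\<exists>y. (phi \<theta> has_real_derivative y) (at x) \<and> 0 \<le> y"
        using has_derivative_phi[of x] x c by auto
    qed
  next
    case False
    then have "c \<le> a" by simp
    then show ?thesis
    proof (rule DERIV_nonpos_imp_nonincreasing)
      fix x assume x: "c \<le> x" "x \<le> a"
      then have "(2 * \<theta> * x * (1 - x) - 1) / (1 - x) \<le> 0"
        using a c th unfolding phi_deriv_factor[OF th] c_def[symmetric]
        by (intro divide_nonpos_nonneg mult_nonpos_nonneg mult_nonneg_nonpos) auto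
      then show "\<exists>y. (phi \<theta> has_real_derivative y) (at x) \<and> y \<le> 0"
        using has_derivative_phi[of x] x a by auto
    qed
  qed
  then show ?thesis using m_fun_eq_phi[OF th] by (simp add: c_def)
qed

text \<open>Up to \<open>1 - c\<close> the function falls from \<open>phi \<theta> 0 = 0\<close>;
  between \<open>1 - c\<close> and \<open>1 / 2\<close> it rises to a value already bounded by
  \<open>m_fun \<theta>\<close>.\<close>

lemma phi_le_max:
  assumes th: "\<theta> \<ge> 2" and a: "0 \<le> a" "a < 1"
  shows "phi \<theta> a \<le> max 0 (m_fun \<theta>)"
proof -
  define c where "c = outer_crit \<theta>"
  have c: "1 / 2 \<le> c" "c < 1" using outer_crit_bounds[OF th] by (auto simp: c_def)
  consider "a \<ge> 1 / 2" | "a \<le> 1 - c" | "1 - c \<le> a" "a \<le> 1 / 2" by linarith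
  then show ?thesis
  proof cases
    case 1
    then show ?thesis using phi_le_m_fun[OF th] a by fastforce
  next
    case 2
    have "phi \<theta> a \<le> phi \<theta> 0"
    proof (rule DERIV_nonpos_imp_nonincreasing[OF a(1)])
      fix x assume x: "0 \<le> x" "x \<le> a"
      then have "(2 * \<theta> * x * (1 - x) - 1) / (1 - x) \<le> 0"
        using 2 a c th unfolding phi_deriv_factor[OF th] c_def[symmetric]
        by (intro divide_nonpos_nonneg mult_nonneg_nonpos) auto
      then show "\<exists>y. (phi \<theta> has_real_derivative y) (at x) \<and> y \<le> 0"
        using has_derivative_phi[of x] x a by auto
    qed
    then show ?thesis by (simp add: phi_def)
  next
    case 3
    have "phi \<theta> a \<le> phi \<theta> (1 / 2)"
    proof (rule DERIV_nonneg_imp_nondecreasing[OF 3(2)])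
      fix x :: real assume x: "a \<le> x" "x \<le> 1 / 2"
      then have "(2 * \<theta> * x * (1 - x) - 1) / (1 - x) \<ge> 0"
        using 3 a c th unfolding phi_deriv_factor[OF th] c_def[symmetric]
        by (intro divide_nonneg_nonneg mult_nonneg_nonneg) auto
      then show "\<exists>y. (phi \<theta> has_real_derivative y) (at x) \<and> 0 \<le> y"
        using has_derivative_phi[of x] x by force
    qed
    then show ?thesis using phi_le_m_fun[OF th, of "1 / 2"] by simp
  qed
qed

section \<open>The threshold \<open>theta_c\<close> and the resulting gain in free energy\<close>

lemma m_fun_strict_mono:
  assumes "2 \<le> s" "s < t"
  shows "m_fun s < m_fun t"
proof -
  have c: "1 / 2 \<le> outer_crit s" "outer_crit s < 1"
    using outer_crit_bounds[of s] assms by auto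
  have "m_fun s = phi s (outer_crit s)" using m_fun_eq_phi assms by simp
  \<comment> \<open>The maximizer for \<open>s\<close> serves as a trial point for \<open>t\<close>;
    at a fixed \<open>a > 0\<close>, \<open>phi\<close> grows strictly with its parameter.\<close>
  also have "\<dots> < phi t (outer_crit s)" using assms c by (simp add: phi_def)
  also have "\<dots> \<le> m_fun t" using phi_le_m_fun[of t] assms c by simp
  finally show ?thesis .
qed

text \<open>Here \<open>m_fun 2 = 1 / 2 - ln 2\<close>, so the claim amounts to
  \<open>exp 1 < 4\<close>.\<close>

lemma m_fun_2_neg: "m_fun 2 < 0"
proof -
  have "exp (1 / 2 :: real) < 2"
  proof -
    have "(exp (1 / 2 :: real))\<^sup>2 = exp 1" by (simp flip: exp_of_nat_mult)
    also have "\<dots> < 2\<^sup>2" using exp_le by simp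
    finally show ?thesis by (rule power_less_imp_less_base) simp
  qed
  then have "1 / 2 < ln (2 :: real)" by (metis exp_less_cancel_iff exp_ln zero_less_numeral)
  then show ?thesis by (simp add: m_fun_def ln_div)
qed

text \<open>At parameter 4 the simple trial point \<open>1 / 2\<close> already gives the positive
  value \<open>1 - ln 2\<close>.\<close>

lemma m_fun_4_pos: "m_fun 4 > 0"
proof -
  have "0 < phi 4 (1 / 2)" using ln_2_less_1 by (simp add: phi_def ln_div power2_eq_square)
  also have "\<dots> \<le> m_fun 4" by (rule phi_le_m_fun) auto
  finally show ?thesis .
qed

text \<open>The intermediate value theorem on \<open>{2..4}\<close> yields a zero and strict
  monotonicity makes it unique, which justifies the definite description.\<close>

lemma theta_c: "theta_c \<ge> 2" "m_fun theta_c = 0"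
proof -
  have "continuous_on {2..4} m_fun"
    unfolding m_fun_def[abs_def]
  proof (intro continuous_intros)
    show "\<forall>x\<in>{2..4}. (1::real) / 2 - 1 / 2 * sqrt (1 - 2 / x) \<noteq> 0"
    proof
      fix x :: real assume "x \<in> {2..4}"
      then have "sqrt (1 - 2 / x) < 1" by (simp add: real_less_lsqrt field_simps)
      then show "(1::real) / 2 - 1 / 2 * sqrt (1 - 2 / x) \<noteq> 0" by simp
    qed
  qed auto
  then obtain t where t: "2 \<le> t" "m_fun t = 0"
    using IVT'[of m_fun 2 0 4] m_fun_2_neg m_fun_4_pos by auto
  have "theta_c \<ge> 2 \<and> m_fun theta_c = 0"
    unfolding theta_c_def
  proof (rule theI)
    show "t \<ge> 2 \<and> m_fun t = 0" using t by simp
    fix s assume "s \<ge> 2 \<and> m_fun s = 0"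
    then show "s = t" using t m_fun_strict_mono[of s t] m_fun_strict_mono[of t s] by fastforce
  qed
  then show "theta_c \<ge> 2" "m_fun theta_c = 0" by auto
qed

text \<open>The maximum of \<open>phi \<theta>\<close> on \<open>[0, 1)\<close>, and also the part
  of \<open>Ffree\<close> beyond \<open>ln (B * pi * exp 1)\<close>.\<close>

definition excess :: "real \<Rightarrow> real" where
  "excess \<theta> = (if \<theta> \<le> theta_c then 0 else m_fun \<theta>)"

lemma excess_nonneg: "excess \<theta> \<ge> 0"
  using m_fun_strict_mono[of theta_c \<theta>] theta_c by (auto simp: excess_def)

text \<open>Below the threshold, monotonicity of \<open>phi\<close> in its parameter reduces the
  bound to \<open>theta_c\<close>, where both candidates for the maximum are 0.\<close>

lemma phi_le_excess:
  assumes a: "0 \<le> a" "a < 1"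
  shows "phi \<theta> a \<le> excess \<theta>"
proof (cases "\<theta> \<le> theta_c")
  case True
  then have "phi \<theta> a \<le> phi theta_c a" by (simp add: phi_def mult_right_mono)
  also have "\<dots> \<le> 0" using phi_le_max[OF theta_c(1) a] theta_c by simp
  finally show ?thesis using True by (simp add: excess_def)
next
  case False
  then have "phi \<theta> a \<le> max 0 (m_fun \<theta>)" using theta_c by (intro phi_le_max a) auto
  also have "\<dots> = excess \<theta>" using False excess_nonneg[of \<theta>] by (simp add: excess_def)
  finally show ?thesis .
qed

lemma Ffree_eq:
  assumes "B > 0"
  shows "Ffree \<beta> B = ln B + ln pi + 1 + excess (\<beta> * B\<^sup>2)"
  using assms by (simp add: Ffree_def excess_def ln_mult)

text \<open>Of the \<open>n\<close> factors \<open>1 - a\<close> that would balance the energy,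
  \<open>k\<close> are missing. Splitting the energy accordingly, these cost at most
  \<open>\<theta>\<close> each because \<open>a\<^sup>2 \<le> 1\<close>.\<close>

lemma exp_tilt_le:
  fixes \<theta> :: real and n k :: nat
  assumes a: "0 \<le> a" "a \<le> 1" and th: "\<theta> \<ge> 0" and k: "k < n"
  shows "exp (real n * \<theta> * a\<^sup>2) * (1 - a) ^ (n - k) \<le> exp (real n * excess \<theta> + real k * \<theta>)"
\<comment> \<open>At \<open>a = 1\<close> the power vanishes because \<open>k < n\<close>; the
  logarithmic form requires \<open>a < 1\<close>.\<close>
proof (cases "a = 1")
  case True
  then show ?thesis using k by (simp add: power_0_left)
next
  case False
  then have a1: "a < 1" using a by simp
  have p: "(1 - a) ^ (n - k) = exp ((real n - real k) * ln (1 - a))"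
    using a1 k by (simp add: exp_of_nat_mult of_nat_diff flip: of_nat_diff)
  have "real n * \<theta> * a\<^sup>2 + (real n - real k) * ln (1 - a)
      = (real n - real k) * phi \<theta> a + real k * (\<theta> * a\<^sup>2)"
    by (simp add: phi_def algebra_simps)
  also have "\<dots> \<le> (real n - real k) * excess \<theta> + real k * (\<theta> * 1)"
    using a a1 th k phi_le_excess[of a \<theta>]
    by (intro add_mono mult_left_mono power_le_one) auto
  also have "\<dots> \<le> real n * excess \<theta> + real k * \<theta>"
    using excess_nonneg[of \<theta>] by (simp add: mult_right_mono)
  finally show ?thesis unfolding p by (simp flip: exp_add)
qed

section \<open>Factorials\<close>

text \<open>A crude Stirling formula by induction. With \<open>d\<close> the increment of the
  logarithm from \<open>n\<close> to \<open>Suc n\<close>, \<open>ln y \<le> y - 1\<close> gives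
  both \<open>n * d \<le> 1\<close> and \<open>Suc n * d \<ge> 1\<close>.\<close>

lemma ln_fact_bounds:
  assumes "n \<ge> 1"
  shows "real n * ln (real n) - real n \<le> ln (fact n)"
    and "ln (fact n) \<le> real n * ln (real n) - real n + ln (real n) + 1"
proof -
  have "real n * ln (real n) - real n \<le> ln (fact n) \<and>
     ln (fact n) \<le> real n * ln (real n) - real n + ln (real n) + 1"
    using assms
  proof (induction n rule: nat_induct_at_least)
    case base
    show ?case by simp
  next
    case (Suc n)
    then have n: "real n > 0" by simp
    define d where "d = ln (real (Suc n)) - ln (real n)"
    have "d = ln (real (Suc n) / real n)" using n by (simp add: d_def ln_div)
    also have "\<dots> \<le> real (Suc n) / real n - 1" using n by (intro ln_le_minus_one) auto
    finally have u: "real n * d \<le> 1" using n by (simp add: field_simps)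
    have "- d = ln (real n / real (Suc n))" using n by (simp add: d_def ln_div)
    also have "\<dots> \<le> real n / real (Suc n) - 1" using n by (intro ln_le_minus_one) auto
    finally have l: "real (Suc n) * d \<ge> 1" using n by (simp add: field_simps)
    have f: "ln (fact (Suc n) :: real) = ln (real (Suc n)) + ln (fact n)"
      by (simp add: ln_mult del: of_nat_Suc)
    have "real (Suc n) * ln (real (Suc n))
        = real n * ln (real n) + real n * d + ln (real (Suc n))"
      and "real (Suc n) * d = real n * d + d"
      and "ln (real (Suc n)) = ln (real n) + d"
      and "real (Suc n) = real n + 1"
      by (simp_all add: d_def algebra_simps)
    with Suc.IH f u l show ?case by linarith
  qed
  then show "real n * ln (real n) - real n \<le> ln (fact n)"
    "ln (fact n) \<le> real n * ln (real n) - real n + ln (real n) + 1" by auto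
qed

section \<open>Volumes of balls\<close>

definition mass :: "'a set \<Rightarrow> ('a \<Rightarrow> complex) \<Rightarrow> real" where
  "mass A f = (\<Sum>x\<in>A. (cmod (f x))\<^sup>2)"

lemma mass_nonneg: "mass A f \<ge> 0"
  by (simp add: mass_def sum_nonneg)

lemma measurable_mass [measurable]:
  assumes "A \<subseteq> I"
  shows "mass A \<in> borel_measurable (Pi\<^sub>M I (\<lambda>_. lborel))"
proof -
  have "(\<lambda>f. \<Sum>x\<in>A. (cmod (f x))\<^sup>2) \<in> borel_measurable (Pi\<^sub>M I (\<lambda>_. lborel :: complex measure))"
  proof (rule borel_measurable_sum)
    fix x assume "x \<in> A"
    then have [measurable]: "x \<in> I" using assms by auto
    show "(\<lambda>f. (cmod (f x))\<^sup>2) \<in> borel_measurable (Pi\<^sub>M I (\<lambda>_. lborel :: complex measure))"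
      by measurable
  qed
  then show ?thesis by (simp add: mass_def[abs_def])
qed

lemma emeasure_cmod_le:
  assumes "t \<ge> 0"
  shows "emeasure lborel {z::complex. (cmod z)\<^sup>2 \<le> t} = ennreal (pi * t)"
proof -
  have "{z::complex. (cmod z)\<^sup>2 \<le> t} = cball 0 (sqrt t)"
    using assms by (auto simp: real_le_rsqrt sqrt_ge_absD real_sqrt_le_iff' dest: real_le_rsqrt)
  then show ?thesis using assms emeasure_cball[of "sqrt t" "0::complex"]
    by (simp add: eval_unit_ball_vol)
qed

lemma emeasure_cmod_less:
  assumes "t \<ge> 0"
  shows "emeasure lborel {z::complex. (cmod z)\<^sup>2 < t} = ennreal (pi * t)"
proof -
  have "{z::complex. (cmod z)\<^sup>2 < t} = ball 0 (sqrt t)"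
    using assms by (auto simp: real_less_rsqrt)
       (metis norm_ge_zero power_strict_mono real_sqrt_pow2 zero_less_numeral)
  then show ?thesis using assms emeasure_ball[of "sqrt t" "0::complex"]
    by (simp add: eval_unit_ball_vol)
qed

text \<open>A substitute for polar coordinates: the squared modulus pushes planar Lebesgue measure
  to \<open>pi\<close> times linear measure. The variable \<open>t - (cmod z)\<^sup>2\<close> is the
  mass left for other sites.\<close>

lemma nn_integral_cmod_square:
  fixes g :: "real \<Rightarrow> ennreal"
  assumes t: "t \<ge> 0" and [measurable]: "g \<in> borel_measurable borel"
  shows "(\<integral>\<^sup>+z. g (t - (cmod z)\<^sup>2) * indicator {..t} ((cmod z)\<^sup>2) \<partial>(lborel :: complex measure))
    = ennreal pi * (\<integral>\<^sup>+u. g u * indicator {0..t} u \<partial>lborel)"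
proof -
  define M where "M = distr (density lborel (\<lambda>z::complex. indicator {..t} ((cmod z)\<^sup>2)))
    borel (\<lambda>z. t - (cmod z)\<^sup>2)"
  define N where "N = density lborel (\<lambda>u. ennreal pi * indicator {0..t} u)"
  have M: "emeasure M {x<..} = emeasure lborel {z::complex. (cmod z)\<^sup>2 \<le> t \<and> (cmod z)\<^sup>2 < t - x}" for x
  proof -
    have [measurable]: "{z::complex. (cmod z)\<^sup>2 \<le> t \<and> (cmod z)\<^sup>2 < t - x} \<in> sets lborel"
      by measurable
    have "emeasure M {x<..} = emeasure (density lborel (\<lambda>z::complex. indicator {..t} ((cmod z)\<^sup>2)))
        {z::complex. (cmod z)\<^sup>2 < t - x}"
      unfolding M_def by (subst emeasure_distr) (auto intro!: arg_cong2[where f = emeasure])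
    also have "\<dots> = (\<integral>\<^sup>+z. indicator {z::complex. (cmod z)\<^sup>2 \<le> t \<and> (cmod z)\<^sup>2 < t - x} z \<partial>lborel)"
      by (subst emeasure_density, simp, simp, intro nn_integral_cong) (auto simp: indicator_def)
    finally show ?thesis by simp
  qed
  have N: "emeasure N {x<..} = ennreal pi * emeasure lborel ({0..t} \<inter> {x<..})" for x
    unfolding N_def
    by (simp add: emeasure_density mult.assoc nn_integral_cmult flip: indicator_inter_arith)
  \<comment> \<open>Both values are \<open>pi\<close> times the length of
    \<open>{0..t} \<inter> {x<..}\<close>. Agreement on these half-lines, with finite values,
    identifies the two measures.\<close>
  have MN: "emeasure M {x<..} = ennreal (pi * max 0 (t - max 0 x)) \<and>
            emeasure N {x<..} = ennreal (pi * max 0 (t - max 0 x))" for x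
  proof -
    consider "x < 0" | "0 \<le> x" "x \<le> t" | "t < x" by linarith
    then show ?thesis
    proof cases
      case 1
      then have "{z::complex. (cmod z)\<^sup>2 \<le> t \<and> (cmod z)\<^sup>2 < t - x} = {z. (cmod z)\<^sup>2 \<le> t}"
        "{0..t} \<inter> {x<..} = {0..t}" by auto
      then show ?thesis using 1 t by (simp add: M N emeasure_cmod_le ennreal_mult)
    next
      case 2
      then have "{z::complex. (cmod z)\<^sup>2 \<le> t \<and> (cmod z)\<^sup>2 < t - x} = {z. (cmod z)\<^sup>2 < t - x}"
        "{0..t} \<inter> {x<..} = {x<..t}" by auto
      then show ?thesis using 2 t by (simp add: M N emeasure_cmod_less ennreal_mult)
    next
      case 3
      have "\<not> (cmod z)\<^sup>2 < t - x" for z using 3 zero_le_power2[of "cmod z"] by linarith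
      then have "{z::complex. (cmod z)\<^sup>2 \<le> t \<and> (cmod z)\<^sup>2 < t - x} = {}"
        "{0..t} \<inter> {x<..} = {}" using 3 by auto
      then show ?thesis using 3 t by (simp only: M N) simp
    qed
  qed
  have "M = N"
    by (rule measure_eqI_lessThan) (use MN in \<open>auto simp: M_def N_def\<close>)
  have "(\<integral>\<^sup>+z. g (t - (cmod z)\<^sup>2) * indicator {..t} ((cmod z)\<^sup>2) \<partial>(lborel :: complex measure))
      = (\<integral>\<^sup>+u. g u \<partial>M)"
    unfolding M_def by (simp add: nn_integral_distr nn_integral_density mult.commute)
  also have "\<dots> = (\<integral>\<^sup>+u. g u \<partial>N)" by (simp add: \<open>M = N\<close>)
  also have "\<dots> = (\<integral>\<^sup>+u. ennreal pi * (g u * indicator {0..t} u) \<partial>lborel)"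
    unfolding N_def by (simp add: nn_integral_density mult_ac)
  also have "\<dots> = ennreal pi * (\<integral>\<^sup>+u. g u * indicator {0..t} u \<partial>lborel)"
    by (rule nn_integral_cmult) measurable
  finally show ?thesis .
qed

lemma nn_integral_power:
  fixes t :: real
  assumes "t \<ge> 0"
  shows "(\<integral>\<^sup>+u. ennreal (u ^ k) * indicator {0..t} u \<partial>lborel) = ennreal (t ^ Suc k / real (Suc k))"
proof -
  have "(\<integral>\<^sup>+u. ennreal (u ^ k) * indicator {0..t} u \<partial>lborel)
      = ennreal (t ^ Suc k / real (Suc k) - 0 ^ Suc k / real (Suc k))"
    using assms
    by (intro nn_integral_FTC_Icc)
       (auto intro!: derivative_eq_intros simp: field_simps simp del: of_nat_Suc power_Suc)
  then show ?thesis by simp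
qed

text \<open>The volume of the ball of squared radius \<open>t\<close> in complex dimension
  \<open>k\<close>. The explicit 0 for negative \<open>t\<close> builds in the cutoff when the
  remaining mass \<open>t - s\<close> is substituted; a bare even power would stay positive
  there.\<close>

definition ball_vol :: "nat \<Rightarrow> real \<Rightarrow> real" where
  "ball_vol k t = (if t < 0 then 0 else pi ^ k * t ^ k / fact k)"

lemma ball_vol_nonneg: "ball_vol k t \<ge> 0"
  by (simp add: ball_vol_def)

text \<open>Induction on the coordinates by Fubini: fixing the new coordinate \<open>z\<close>
  leaves a ball of squared radius \<open>t - (cmod z)\<^sup>2\<close>, and the outer integral
  becomes that of a power over \<open>{0..t}\<close>.\<close>

lemma nn_integral_mass_le:
  assumes "finite A"
  shows "(\<integral>\<^sup>+f. indicator {..t} (mass A f) \<partial>Pi\<^sub>M A (\<lambda>_. lborel)) = ennreal (ball_vol (card A) t)"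
  using assms
proof (induction arbitrary: t rule: finite_induct)
  case empty
  then show ?case by (simp add: PiM_empty mass_def ball_vol_def indicator_def)
next
  case (insert b A)
  have mult3: "ennreal pi * (ennreal a * ennreal c) = ennreal (pi * (a * c))"
    if "a \<ge> 0" "c \<ge> 0" for a c
    using that by (simp add: ennreal_mult)
  interpret product_sigma_finite "\<lambda>_. lborel :: complex measure" by standard
  let ?k = "card A"
  have upd: "mass (insert b A) (f(b := z)) = (cmod z)\<^sup>2 + mass A f" for f and z :: complex
  proof -
    have "mass A (f(b := z)) = mass A f"
      unfolding mass_def using insert.hyps by (intro sum.cong) auto
    then show ?thesis using insert.hyps by (simp add: mass_def)
  qed
  have "(\<integral>\<^sup>+f. indicator {..t} (mass (insert b A) f) \<partial>Pi\<^sub>M (insert b A) (\<lambda>_. lborel))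
      = (\<integral>\<^sup>+z. \<integral>\<^sup>+f. indicator {..t} (mass (insert b A) (f(b := z))) \<partial>Pi\<^sub>M A (\<lambda>_. lborel) \<partial>lborel)"
    using insert.hyps by (intro product_nn_integral_insert_rev) auto
  also have "\<dots> = (\<integral>\<^sup>+z. \<integral>\<^sup>+f. indicator {..t - (cmod z)\<^sup>2} (mass A f) \<partial>Pi\<^sub>M A (\<lambda>_. lborel) \<partial>lborel)"
    unfolding upd by (intro nn_integral_cong) (auto simp: indicator_def)
  also have "\<dots> = (\<integral>\<^sup>+z. ennreal (ball_vol ?k (t - (cmod z)\<^sup>2)) \<partial>lborel)"
    by (simp add: insert.IH)
  also have "\<dots> = ennreal (ball_vol (Suc ?k) t)"
  proof (cases "t < 0")
    case True
    then have "t - (cmod z)\<^sup>2 < 0" for z by (smt (verit) zero_le_power2)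
    then show ?thesis using True by (simp add: ball_vol_def)
  next
    case False
    have "(\<integral>\<^sup>+z. ennreal (ball_vol ?k (t - (cmod z)\<^sup>2)) \<partial>lborel)
        = (\<integral>\<^sup>+z. ennreal (pi ^ ?k / fact ?k * (t - (cmod z)\<^sup>2) ^ ?k) * indicator {..t} ((cmod z)\<^sup>2) \<partial>lborel)"
      by (intro nn_integral_cong) (auto simp: ball_vol_def indicator_def)
    also have "\<dots> = ennreal pi * (\<integral>\<^sup>+u. ennreal (pi ^ ?k / fact ?k * u ^ ?k) * indicator {0..t} u \<partial>lborel)"
      using False by (intro nn_integral_cmod_square) auto
    also have "(\<integral>\<^sup>+u. ennreal (pi ^ ?k / fact ?k * u ^ ?k) * indicator {0..t} u \<partial>lborel)
        = (\<integral>\<^sup>+u. ennreal (pi ^ ?k / fact ?k) * (ennreal (u ^ ?k) * indicator {0..t} u) \<partial>lborel)"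
      by (intro nn_integral_cong) (auto simp: indicator_def simp flip: ennreal_mult)
    also have "\<dots> = ennreal (pi ^ ?k / fact ?k) * ennreal (t ^ Suc ?k / real (Suc ?k))"
      using False by (subst nn_integral_cmult) (auto simp: nn_integral_power simp del: of_nat_Suc power_Suc)
    also have "ennreal pi * \<dots> = ennreal (pi * (pi ^ ?k / fact ?k * (t ^ Suc ?k / real (Suc ?k))))"
      using mult3[of "pi ^ ?k / fact ?k" "t ^ Suc ?k / real (Suc ?k)"] False by simp
    also have "pi * (pi ^ ?k / fact ?k * (t ^ Suc ?k / real (Suc ?k))) = ball_vol (Suc ?k) t"
      using False by (simp add: ball_vol_def field_simps)
    finally show ?thesis .
  qed
  finally show ?case using insert.hyps by simp
qed

text \<open>Fubini again: once the mass on \<open>I\<close> is fixed, the sites of \<open>J\<close>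
  range freely over a ball holding the remaining mass.\<close>

lemma nn_integral_mass_split:
  fixes g :: "real \<Rightarrow> ennreal"
  assumes IJ: "finite I" "finite J" "I \<inter> J = {}" and [measurable]: "g \<in> borel_measurable borel"
  shows "(\<integral>\<^sup>+f. g (mass I f) * indicator {..t} (mass (I \<union> J) f) \<partial>Pi\<^sub>M (I \<union> J) (\<lambda>_. lborel))
    = (\<integral>\<^sup>+f. g (mass I f) * ennreal (ball_vol (card J) (t - mass I f)) \<partial>Pi\<^sub>M I (\<lambda>_. lborel))"
proof -
  interpret product_sigma_finite "\<lambda>_. lborel :: complex measure" by standard
  have [measurable]: "mass I \<in> borel_measurable (Pi\<^sub>M (I \<union> J) (\<lambda>_. lborel))"
    "mass (I \<union> J) \<in> borel_measurable (Pi\<^sub>M (I \<union> J) (\<lambda>_. lborel))"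
    "mass J \<in> borel_measurable (Pi\<^sub>M J (\<lambda>_. lborel))"
    by (intro measurable_mass; blast)+
  have m1: "mass I (merge I J (x, y)) = mass I x" for x y
    unfolding mass_def by (intro sum.cong) (auto simp: merge_def)
  have m2: "mass (I \<union> J) (merge I J (x, y)) = mass I x + mass J y" for x y
  proof -
    have "mass J (merge I J (x, y)) = mass J y"
      unfolding mass_def using IJ by (intro sum.cong) (auto simp: merge_def)
    then show ?thesis using IJ m1[of x y] by (simp add: mass_def sum.union_disjoint)
  qed
  have "(\<integral>\<^sup>+f. g (mass I f) * indicator {..t} (mass (I \<union> J) f) \<partial>Pi\<^sub>M (I \<union> J) (\<lambda>_. lborel))
      = (\<integral>\<^sup>+x. \<integral>\<^sup>+y. g (mass I x) * indicator {..t - mass I x} (mass J y)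
          \<partial>Pi\<^sub>M J (\<lambda>_. lborel) \<partial>Pi\<^sub>M I (\<lambda>_. lborel))"
    using IJ by (subst product_nn_integral_fold)
      (auto simp: m1 m2 indicator_def algebra_simps intro!: nn_integral_cong)
  also have "\<dots> = (\<integral>\<^sup>+x. g (mass I x) * ennreal (ball_vol (card J) (t - mass I x)) \<partial>Pi\<^sub>M I (\<lambda>_. lborel))"
    using IJ by (intro nn_integral_cong) (simp add: nn_integral_cmult nn_integral_mass_le)
  finally show ?thesis .
qed

text \<open>The difference of two discs, computed by adding the inner disc and cancelling its finite
  area in \<open>ennreal\<close>. The lower bound uses it to hold one site near its optimal
  mass.\<close>

lemma nn_integral_annulus:
  assumes "0 \<le> u" "u \<le> v"
  shows "(\<integral>\<^sup>+f. indicator {u<..v} (mass {b} f) \<partial>Pi\<^sub>M {b} (\<lambda>_. lborel)) = ennreal (pi * (v - u))"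
    (is "?X = _")
proof -
  have [measurable]: "mass {b} \<in> borel_measurable (Pi\<^sub>M {b} (\<lambda>_. lborel))"
    by (intro measurable_mass) auto
  have V: "(\<integral>\<^sup>+f. indicator {..w} (mass {b} f) \<partial>Pi\<^sub>M {b} (\<lambda>_. lborel)) = ennreal (pi * w)"
    if "w \<ge> 0" for w
    using nn_integral_mass_le[of "{b}" w] that by (simp add: ball_vol_def)
  have "ennreal (pi * u) + ?X
      = (\<integral>\<^sup>+f. indicator {..u} (mass {b} f) + indicator {u<..v} (mass {b} f) \<partial>Pi\<^sub>M {b} (\<lambda>_. lborel))"
    using assms by (simp add: nn_integral_add V)
  also have "\<dots> = (\<integral>\<^sup>+f. indicator {..v} (mass {b} f) \<partial>Pi\<^sub>M {b} (\<lambda>_. lborel))"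
    using assms by (intro nn_integral_cong) (auto simp: indicator_def)
  also have "\<dots> = ennreal (pi * v)" using assms by (simp add: V)
  also have "\<dots> = ennreal (pi * u) + ennreal (pi * (v - u))"
    using assms by (simp add: algebra_simps flip: ennreal_plus)
  finally show ?thesis by (simp add: ennreal_add_left_cancel)
qed

section \<open>The quartic weight\<close>

definition quartic :: "'a set \<Rightarrow> ('a \<Rightarrow> complex) \<Rightarrow> real" where
  "quartic A f = (\<Sum>x\<in>A. (cmod (f x)) ^ 4)"

lemma quartic_eq: "quartic A f = (\<Sum>x\<in>A. ((cmod (f x))\<^sup>2)\<^sup>2)"
  by (simp add: quartic_def)

lemma measurable_quartic [measurable]:
  assumes "A \<subseteq> I"
  shows "quartic A \<in> borel_measurable (Pi\<^sub>M I (\<lambda>_. lborel))"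
proof -
  have "(\<lambda>f. \<Sum>x\<in>A. (cmod (f x)) ^ 4) \<in> borel_measurable (Pi\<^sub>M I (\<lambda>_. lborel :: complex measure))"
  proof (rule borel_measurable_sum)
    fix x assume "x \<in> A"
    then have [measurable]: "x \<in> I" using assms by auto
    show "(\<lambda>f. (cmod (f x)) ^ 4) \<in> borel_measurable (Pi\<^sub>M I (\<lambda>_. lborel :: complex measure))"
      by measurable
  qed
  then show ?thesis by (simp add: quartic_def[abs_def])
qed

text \<open>The quartic sum is largest when all the mass sits on one site; this lets a concentrated
  set be treated like a single site.\<close>

lemma quartic_le_mass_square:
  assumes "finite A"
  shows "quartic A f \<le> (mass A f)\<^sup>2"
proof -
  have "quartic A f \<le> (\<Sum>x\<in>A. (cmod (f x))\<^sup>2 * mass A f)"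
    unfolding quartic_eq
  proof (rule sum_mono)
    fix x assume "x \<in> A"
    then have "(cmod (f x))\<^sup>2 \<le> mass A f"
      unfolding mass_def using assms by (intro member_le_sum) auto
    then show "((cmod (f x))\<^sup>2)\<^sup>2 \<le> (cmod (f x))\<^sup>2 * mass A f"
      unfolding power2_eq_square[of "(cmod (f x))\<^sup>2"] by (intro mult_left_mono) auto
  qed
  then show ?thesis by (simp add: mass_def power2_eq_square sum_distrib_right)
qed

text \<open>Fewer than \<open>k\<close> sites exceed the average \<open>t / k\<close>; any \<open>k\<close>-set containing them will do.\<close>
lemma concentrated_subset_exists:
  assumes V: "finite V" "k \<le> card V" and k: "k > 0" and t: "t > 0" and f: "mass V f \<le> t"
  shows "\<exists>A. A \<subseteq> V \<and> card A = k \<and> quartic V f \<le> (mass A f)\<^sup>2 + t\<^sup>2 / real k"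
proof -
  define L where "L = {x \<in> V. (cmod (f x))\<^sup>2 > t / real k}"
  have L: "L \<subseteq> V" "finite L" using V by (auto simp: L_def)
  have "real (card L) * (t / real k) \<le> mass L f"
    unfolding mass_def by (rule sum_bounded_below) (auto simp: L_def)
  also have "\<dots> \<le> mass V f" unfolding mass_def using V L by (intro sum_mono2) auto
  also have "\<dots> \<le> t" by (rule f)
  finally have "card L \<le> k" using k t by (simp add: field_simps)
  then obtain A where A: "L \<subseteq> A" "A \<subseteq> V" "card A = k"
    using exists_subset_between[of L k V] L V by auto
  have "quartic (V - A) f \<le> (\<Sum>x\<in>V - A. (cmod (f x))\<^sup>2 * (t / real k))"
    unfolding quartic_eq
  proof (rule sum_mono)
    fix x assume "x \<in> V - A"
    then have "(cmod (f x))\<^sup>2 \<le> t / real k" using A by (auto simp: L_def)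
    then show "((cmod (f x))\<^sup>2)\<^sup>2 \<le> (cmod (f x))\<^sup>2 * (t / real k)"
      unfolding power2_eq_square[of "(cmod (f x))\<^sup>2"] by (intro mult_left_mono) auto
  qed
  also have "\<dots> = mass (V - A) f * (t / real k)" by (simp only: mass_def sum_distrib_right)
  also have "\<dots> \<le> t * (t / real k)"
  proof (rule mult_right_mono)
    have "mass (V - A) f \<le> mass V f" unfolding mass_def using V by (intro sum_mono2) auto
    then show "mass (V - A) f \<le> t" using f by simp
  qed (use t in simp)
  finally have "quartic (V - A) f \<le> t\<^sup>2 / real k" by (simp add: power2_eq_square)
  moreover have "quartic V f = quartic A f + quartic (V - A) f"
    unfolding quartic_def using A V by (metis add.commute sum.subset_diff)
  ultimately show ?thesis
    using A quartic_le_mass_square[of A f] V finite_subset[of A V] by (intro exI[of _ A]) auto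
qed

section \<open>Two-sided bounds for the partition integral without kinetic energy\<close>

definition weight :: "nat \<Rightarrow> real \<Rightarrow> real \<Rightarrow> (nat \<Rightarrow> complex) \<Rightarrow> ennreal" where
  "weight n \<beta> B f = ennreal (exp (\<beta> / real n * quartic {..<n} f))
     * indicator {..B * real n} (mass {..<n} f)"

text \<open>Integrating out the complement of \<open>A\<close> leaves energy times remaining volume
  as a function of the mass on \<open>A\<close> alone. \<open>exp_tilt_le\<close> bounds this
  product by a constant, after which only a ball volume over \<open>A\<close> remains.\<close>

lemma nn_integral_concentrated:
  fixes n k :: nat
  assumes \<beta>: "\<beta> \<ge> 0" and B: "B > 0" and k: "k < n" and A: "A \<subseteq> {..<n}" "card A = k"
  defines "t \<equiv> B * real n" and "\<theta> \<equiv> \<beta> * B\<^sup>2"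
  shows "(\<integral>\<^sup>+f. ennreal (exp (\<beta> / real n * (mass A f)\<^sup>2)) * indicator {..t} (mass {..<n} f)
        \<partial>Pi\<^sub>M {..<n} (\<lambda>_. lborel))
    \<le> ennreal (exp (real n * excess \<theta> + real k * \<theta>) * (pi * t) ^ n / (fact k * fact (n - k)))"
proof -
  have t: "t > 0" using B k by (simp add: t_def)
  define J where "J = {..<n} - A"
  have fin: "finite A" using A(1) finite_subset by blast
  have J: "finite J" "A \<inter> J = {}" "A \<union> J = {..<n}" "card J = n - k"
    using A fin by (auto simp: J_def card_Diff_subset)
  define c where "c = exp (real n * excess \<theta> + real k * \<theta>) * (pi ^ (n - k) * t ^ (n - k) / fact (n - k))"
  have c: "c \<ge> 0" using t by (simp add: c_def)
  have [measurable]: "mass A \<in> borel_measurable (Pi\<^sub>M A (\<lambda>_. lborel))"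
    by (intro measurable_mass) auto
  have pointwise: "exp (\<beta> / real n * s\<^sup>2) * ball_vol (n - k) (t - s) \<le> c * indicator {..t} s"
    if s: "s \<ge> 0" for s
  proof (cases "s \<le> t")
    case True
    \<comment> \<open>In terms of the mass fraction \<open>a\<close>, the energy is
      \<open>n * \<theta> * a\<^sup>2\<close> and the volume carries
      \<open>(1 - a) ^ (n - k)\<close>.\<close>
    define a where "a = s / t"
    have a: "0 \<le> a" "a \<le> 1" "s = a * t" using s t True by (auto simp: a_def)
    have e: "\<beta> / real n * s\<^sup>2 = real n * \<theta> * a\<^sup>2"
      using k by (simp add: a(3) \<theta>_def t_def power2_eq_square)
    have "(t - s) ^ (n - k) = t ^ (n - k) * (1 - a) ^ (n - k)"
      by (simp add: a(3) algebra_simps flip: power_mult_distrib)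
    then have "exp (\<beta> / real n * s\<^sup>2) * ball_vol (n - k) (t - s)
        = (exp (real n * \<theta> * a\<^sup>2) * (1 - a) ^ (n - k)) * (pi ^ (n - k) * t ^ (n - k) / fact (n - k))"
      using True unfolding e by (simp add: ball_vol_def)
    also have "\<dots> \<le> c"
      unfolding c_def using a t k \<beta> by (intro mult_right_mono exp_tilt_le) (auto simp: \<theta>_def)
    finally show ?thesis using True by simp
  qed (simp add: ball_vol_def)
  have "(\<integral>\<^sup>+f. ennreal (exp (\<beta> / real n * (mass A f)\<^sup>2)) * indicator {..t} (mass {..<n} f)
        \<partial>Pi\<^sub>M {..<n} (\<lambda>_. lborel))
      = (\<integral>\<^sup>+f. ennreal (exp (\<beta> / real n * (mass A f)\<^sup>2)) * ennreal (ball_vol (n - k) (t - mass A f))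
        \<partial>Pi\<^sub>M A (\<lambda>_. lborel))"
    using nn_integral_mass_split[OF fin J(1,2), of "\<lambda>s. ennreal (exp (\<beta> / real n * s\<^sup>2))" t]
    by (simp add: J)
  also have "\<dots> \<le> (\<integral>\<^sup>+f. ennreal c * indicator {..t} (mass A f) \<partial>Pi\<^sub>M A (\<lambda>_. lborel))"
  proof (rule nn_integral_mono)
    fix f :: "nat \<Rightarrow> complex"
    have "ennreal (exp (\<beta> / real n * (mass A f)\<^sup>2)) * ennreal (ball_vol (n - k) (t - mass A f))
        = ennreal (exp (\<beta> / real n * (mass A f)\<^sup>2) * ball_vol (n - k) (t - mass A f))"
      by (simp add: ennreal_mult ball_vol_nonneg)
    also have "\<dots> \<le> ennreal (c * indicator {..t} (mass A f))"
      by (intro ennreal_leI pointwise mass_nonneg)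
    also have "\<dots> = ennreal c * indicator {..t} (mass A f)" by (simp add: indicator_def)
    finally show "ennreal (exp (\<beta> / real n * (mass A f)\<^sup>2)) * ennreal (ball_vol (n - k) (t - mass A f))
      \<le> ennreal c * indicator {..t} (mass A f)" .
  qed
  also have "\<dots> = ennreal (c * ball_vol k t)"
    using fin A c by (simp add: nn_integral_cmult nn_integral_mass_le ennreal_mult ball_vol_nonneg)
  also have "c * ball_vol k t
      = exp (real n * excess \<theta> + real k * \<theta>) * (pi * t) ^ n / (fact k * fact (n - k))"
  proof -
    have "(pi * t) ^ n = (pi * t) ^ (n - k) * (pi * t) ^ k" using k by (simp flip: power_add)
    then show ?thesis using t by (simp add: c_def ball_vol_def power_mult_distrib mult_ac)
  qed
  finally show ?thesis .
qed

text \<open>A union bound over all \<open>k\<close>-sets: each configuration is controlled by some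
  concentrated set, and the sum over all sets dominates that one term.\<close>

lemma nn_integral_weight_le:
  fixes n k :: nat
  assumes \<beta>: "\<beta> \<ge> 0" and B: "B > 0" and k: "0 < k" "k < n"
  defines "\<theta> \<equiv> \<beta> * B\<^sup>2"
  shows "(\<integral>\<^sup>+f. weight n \<beta> B f \<partial>Pi\<^sub>M {..<n} (\<lambda>_. lborel))
    \<le> ennreal (exp (real n * (ln B + ln pi + 1 + excess \<theta>)
        + real k * \<theta> + \<theta> * real n / real k + 2 * real k * ln (real n)))"
proof -
  define t where "t = B * real n"
  have t: "t > 0" using B k by (simp add: t_def)
  define S where "S = {A. A \<subseteq> {..<n} \<and> card A = k}"
  have S: "finite S" "card S = n choose k"
    using n_subsets[of "{..<n}" k] by (auto simp: S_def)
  define e where "e = exp (\<theta> * real n / real k)"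
  define u where "u = exp (real n * excess \<theta> + real k * \<theta>) * (pi * t) ^ n / (fact k * fact (n - k))"
  have u: "u \<ge> 0" using t by (simp add: u_def)
  let ?w = "\<lambda>A f. ennreal (exp (\<beta> / real n * (mass A f)\<^sup>2)) * indicator {..t} (mass {..<n} f)"
  have [measurable]: "mass A \<in> borel_measurable (Pi\<^sub>M {..<n} (\<lambda>_. lborel))" if "A \<in> S" for A
    using that by (intro measurable_mass) (auto simp: S_def)
  have [measurable]: "mass {..<n} \<in> borel_measurable (Pi\<^sub>M {..<n} (\<lambda>_. lborel))"
    by (intro measurable_mass) auto
  have "(\<integral>\<^sup>+f. weight n \<beta> B f \<partial>Pi\<^sub>M {..<n} (\<lambda>_. lborel))
      \<le> (\<integral>\<^sup>+f. (\<Sum>A\<in>S. ennreal e * ?w A f) \<partial>Pi\<^sub>M {..<n} (\<lambda>_. lborel))"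
  proof (rule nn_integral_mono)
    fix f :: "nat \<Rightarrow> complex"
    show "weight n \<beta> B f \<le> (\<Sum>A\<in>S. ennreal e * ?w A f)"
    proof (cases "mass {..<n} f \<le> t")
      case True
      obtain A where A: "A \<in> S" "quartic {..<n} f \<le> (mass A f)\<^sup>2 + t\<^sup>2 / real k"
        using concentrated_subset_exists[of "{..<n}" k t f] True t k by (auto simp: S_def)
      have "\<beta> / real n * quartic {..<n} f \<le> \<beta> / real n * ((mass A f)\<^sup>2 + t\<^sup>2 / real k)"
        using A \<beta> by (intro mult_left_mono) auto
      also have "\<dots> = \<theta> * real n / real k + \<beta> / real n * (mass A f)\<^sup>2"
        using k by (simp add: \<theta>_def t_def field_simps power2_eq_square)
      finally have "weight n \<beta> B f \<le> ennreal e * ?w A f"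
        using True by (simp add: weight_def t_def e_def flip: ennreal_mult exp_add)
      also have "\<dots> \<le> (\<Sum>A\<in>S. ennreal e * ?w A f)" using A S by (intro member_le_sum) auto
      finally show ?thesis .
    qed (simp add: weight_def t_def)
  qed
  also have "\<dots> = (\<Sum>A\<in>S. ennreal e * (\<integral>\<^sup>+f. ?w A f \<partial>Pi\<^sub>M {..<n} (\<lambda>_. lborel)))"
    by (simp add: nn_integral_sum nn_integral_cmult)
  also have "\<dots> \<le> (\<Sum>A\<in>S. ennreal e * ennreal u)"
    using nn_integral_concentrated[OF \<beta> B k(2)]
    by (intro sum_mono mult_left_mono) (auto simp: S_def u_def t_def \<theta>_def)
  also have "\<dots> = ennreal (real (n choose k) * (e * u))"
    using S u by (simp add: e_def ennreal_mult ennreal_of_nat_eq_real_of_nat)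
  also have "\<dots> \<le> ennreal (exp (real n * (ln B + ln pi + 1 + excess \<theta>)
        + real k * \<theta> + \<theta> * real n / real k + 2 * real k * ln (real n)))"
  proof (rule ennreal_leI)
    have ch: "real (n choose k) = fact n / (fact k * fact (n - k))"
      using k by (simp add: binomial_fact)
    have ch0: "real (n choose k) > 0" using k by simp
    have "real (n choose k) \<le> real n ^ k"
      using binomial_le_pow[of k n] k by (metis less_imp_le of_nat_mono of_nat_power)
    then have lch: "ln (real (n choose k)) \<le> real k * ln (real n)"
      using ch0 k by (metis ln_le_cancel_iff ln_realpow of_nat_0_less_iff order_less_trans zero_less_power)
    \<comment> \<open>One binomial coefficient counts the sets \<open>A\<close>; the other arises
      from writing \<open>1 / (fact k * fact (n - k))\<close> over \<open>fact n\<close>. Hence the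
      square, and the cost \<open>2 * k * ln n\<close>.\<close>
    have eq: "real (n choose k) * (e * u) = (real (n choose k))\<^sup>2 * (pi * t) ^ n / fact n
        * exp (\<theta> * real n / real k + real n * excess \<theta> + real k * \<theta>)"
      by (simp add: u_def e_def ch exp_add power2_eq_square mult_ac)
    have pos: "real (n choose k) * (e * u) > 0"
      unfolding eq using ch0 t by simp
    have "ln (real (n choose k) * (e * u)) = 2 * ln (real (n choose k))
        + real n * ln (pi * t) - ln (fact n) + (\<theta> * real n / real k + real n * excess \<theta> + real k * \<theta>)"
      unfolding eq using ch0 t by (simp add: ln_mult ln_div ln_realpow)
    also have "real n * ln (pi * t) = real n * (ln pi + ln B + ln (real n))"
      using B k by (simp add: t_def ln_mult)
    also have "2 * ln (real (n choose k)) + \<dots> - ln (fact n)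
        + (\<theta> * real n / real k + real n * excess \<theta> + real k * \<theta>)
      \<le> real n * (ln B + ln pi + 1 + excess \<theta>)
        + real k * \<theta> + \<theta> * real n / real k + 2 * real k * ln (real n)"
      \<comment> \<open>The term \<open>n * ln n\<close> from \<open>ln (pi * t)\<close> cancels
        against the factorial, which leaves the 1 in the free energy.\<close>
      using lch ln_fact_bounds(1)[of n] k by (simp add: algebra_simps)
    finally have "ln (real (n choose k) * (e * u)) \<le> \<dots>" by simp
    then show "real (n choose k) * (e * u) \<le> exp (real n * (ln B + ln pi + 1 + excess \<theta>)
        + real k * \<theta> + \<theta> * real n / real k + 2 * real k * ln (real n))"
      using pos by (metis exp_le_cancel_iff exp_ln)
  qed
  finally show ?thesis .
qed

text \<open>Up to the threshold, the energy factor is at least 1 and the plain ball volume suffices.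
  Above it, site 0 is made to carry close to the optimal fraction \<open>outer_crit \<theta>\<close>
  of the mass.\<close>

lemma nn_integral_weight_ge:
  fixes n :: nat
  assumes \<beta>: "\<beta> \<ge> 0" and B: "B > 0" and n: "n \<ge> 2"
  defines "\<theta> \<equiv> \<beta> * B\<^sup>2"
  shows "ennreal (exp (real n * (ln B + ln pi + 1 + excess \<theta>) - 1 - ln (real n) - 2 * \<theta>))
    \<le> (\<integral>\<^sup>+f. weight n \<beta> B f \<partial>Pi\<^sub>M {..<n} (\<lambda>_. lborel))"
proof -
  define t where "t = B * real n"
  have t: "t > 0" using B n by (simp add: t_def)
  have \<theta>: "\<theta> \<ge> 0" using \<beta> by (simp add: \<theta>_def)
  have lt: "ln t = ln B + ln (real n)" using B n by (simp add: t_def ln_mult)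
  have lf: "ln (fact n) \<le> real n * ln (real n) - real n + ln (real n) + 1"
    using ln_fact_bounds(2)[of n] n by simp
  show ?thesis
  proof (cases "\<theta> \<le> theta_c")
    case True
    have "exp (real n * (ln B + ln pi + 1 + excess \<theta>) - 1 - ln (real n) - 2 * \<theta>)
        \<le> exp (real n * (ln pi + ln t) - ln (fact n))"
      using True lf \<theta> by (simp add: excess_def lt algebra_simps)
    also have "\<dots> = ball_vol n t"
      using t by (simp add: ball_vol_def exp_diff exp_of_nat_mult exp_add power_mult_distrib)
    finally have "ennreal (exp (real n * (ln B + ln pi + 1 + excess \<theta>) - 1 - ln (real n) - 2 * \<theta>))
        \<le> ennreal (ball_vol n t)" by (rule ennreal_leI)
    also have "\<dots> = (\<integral>\<^sup>+f. indicator {..t} (mass {..<n} f) \<partial>Pi\<^sub>M {..<n} (\<lambda>_. lborel))"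
      by (simp add: nn_integral_mass_le)
    also have "\<dots> \<le> (\<integral>\<^sup>+f. weight n \<beta> B f \<partial>Pi\<^sub>M {..<n} (\<lambda>_. lborel))"
    proof (rule nn_integral_mono)
      fix f :: "nat \<Rightarrow> complex"
      have "\<beta> / real n * quartic {..<n} f \<ge> 0" using \<beta> by (simp add: quartic_def sum_nonneg)
      then have "1 \<le> ennreal (exp (\<beta> / real n * quartic {..<n} f))" by simp
      then show "indicator {..t} (mass {..<n} f) \<le> weight n \<beta> B f"
        by (simp add: weight_def t_def indicator_def)
    qed
    finally show ?thesis .
  next
    case False
    then have th2: "\<theta> \<ge> 2" using theta_c by linarith
    define a where "a = outer_crit \<theta>"
    have a: "1 / 2 \<le> a" "a < 1" using outer_crit_bounds[OF th2] by (auto simp: a_def)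
    have ex: "excess \<theta> = \<theta> * a\<^sup>2 + ln (1 - a)"
      using False m_fun_eq_phi[OF th2] by (simp add: excess_def phi_def a_def)
    \<comment> \<open>The annulus for site 0 ends at the optimal mass and has width
      \<open>B\<close>, one average site's share: its area is \<open>pi * B\<close>, and the
      exponent loses at most \<open>2 * \<theta>\<close>.\<close>
    define u v where "u = a * t - B" and "v = a * t"
    have "1 \<le> a * real n" using mult_mono[of "1/2" a 2 "real n"] a n by simp
    then have u: "0 \<le> u" "u \<le> v" using B mult_left_mono[of 1 "a * real n" B]
      by (auto simp: u_def v_def t_def mult_ac)
    define J where "J = {1..<n}"
    have J: "finite {0::nat}" "finite J" "{0} \<inter> J = {}" "{0} \<union> J = {..<n}" "card J = n - 1"
      using n by (auto simp: J_def)
    define g where "g s = ennreal (exp (\<beta> / real n * s\<^sup>2)) * indicator {u<..v} s" for s :: real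
    have g [measurable]: "g \<in> borel_measurable borel" unfolding g_def[abs_def] by measurable
    have [measurable]: "mass {0::nat} \<in> borel_measurable (Pi\<^sub>M {0} (\<lambda>_. lborel))"
      by (intro measurable_mass) auto
    \<comment> \<open>A lower bound valid on the whole annulus: energy taken at the inner edge
      \<open>u\<close>, remaining volume at the outer edge \<open>v\<close>.\<close>
    define c where "c = exp (\<beta> / real n * u\<^sup>2) * ball_vol (n - 1) ((1 - a) * t)"
    have c: "c \<ge> 0" by (simp add: c_def ball_vol_nonneg)
    have bv: "ball_vol (n - 1) ((1 - a) * t) = (pi * ((1 - a) * t)) ^ (n - 1) * real n / fact n"
      using a t n fact_reduce[of n, where ?'a = real]
      by (simp add: ball_vol_def power_mult_distrib not_less)
    \<comment> \<open>The other \<open>n - 1\<close> sites supply all but one factor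
      \<open>pi * B * (1 - a)\<close>. The annulus restores \<open>pi * B\<close>, and the missing
      \<open>1 - a\<close> helps since its logarithm is at most 0.\<close>
    have "real n * (ln B + ln pi + 1 + excess \<theta>) - 1 - ln (real n) - 2 * \<theta>
        \<le> (real n * \<theta> * a\<^sup>2 - 2 * \<theta>)
          + (real n - 1) * (ln pi + ln (1 - a) + ln t) + ln (real n) - ln (fact n) + ln pi + ln B"
    proof -
      have "ln (1 - a) \<le> 0" using a by simp
      then show ?thesis using lf unfolding ex lt by (simp add: algebra_simps)
    qed
    also have "\<dots> \<le> \<beta> / real n * u\<^sup>2
          + (real n - 1) * (ln pi + ln (1 - a) + ln t) + ln (real n) - ln (fact n) + ln pi + ln B"
    proof -
      have "\<beta> / real n * u\<^sup>2 = real n * \<theta> * a\<^sup>2 - 2 * \<theta> * a + \<theta> / real n"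
        using n by (simp add: u_def t_def \<theta>_def field_simps power2_eq_square)
      moreover have "\<theta> * a \<le> \<theta> * 1" using \<theta> a by (intro mult_left_mono) auto
      moreover have "\<theta> / real n \<ge> 0" using \<theta> by simp
      ultimately show ?thesis by simp
    qed
    also have "\<dots> = ln (c * (pi * B))"
    proof -
      have "ln ((pi * ((1 - a) * t)) ^ (n - 1)) = (real n - 1) * (ln pi + ln (1 - a) + ln t)"
        using a t n by (simp add: ln_realpow ln_mult of_nat_diff)
      then show ?thesis
        unfolding c_def bv using a t n B by (simp add: ln_mult ln_div)
    qed
    finally have "exp (real n * (ln B + ln pi + 1 + excess \<theta>) - 1 - ln (real n) - 2 * \<theta>)
        \<le> exp (ln (c * (pi * B)))" by simp
    also have "exp (ln (c * (pi * B))) = c * (pi * B)"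
      unfolding c_def bv using a t n B by (intro exp_ln) simp
    finally have "ennreal (exp (real n * (ln B + ln pi + 1 + excess \<theta>) - 1 - ln (real n) - 2 * \<theta>))
        \<le> ennreal (c * (pi * (v - u)))" by (intro ennreal_leI) (simp add: u_def v_def)
    also have "\<dots> = (\<integral>\<^sup>+f. ennreal c * indicator {u<..v} (mass {0::nat} f) \<partial>Pi\<^sub>M {0} (\<lambda>_. lborel))"
      using u c by (simp add: nn_integral_cmult nn_integral_annulus ennreal_mult)
    also have "\<dots> \<le> (\<integral>\<^sup>+f. g (mass {0::nat} f) * ennreal (ball_vol (card J) (t - mass {0} f)) \<partial>Pi\<^sub>M {0} (\<lambda>_. lborel))"
    proof (rule nn_integral_mono)
      fix f :: "nat \<Rightarrow> complex"
      show "ennreal c * indicator {u<..v} (mass {0} f)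
        \<le> g (mass {0} f) * ennreal (ball_vol (card J) (t - mass {0} f))"
      proof (cases "mass {0} f \<in> {u<..v}")
        case True
        define s where "s = mass {0} f"
        have s: "u < s" "s \<le> v" using True by (auto simp: s_def)
        have "exp (\<beta> / real n * u\<^sup>2) \<le> exp (\<beta> / real n * s\<^sup>2)"
          using s u \<beta> by (auto intro!: divide_right_mono mult_left_mono power_mono)
        moreover have "ball_vol (n - 1) ((1 - a) * t) \<le> ball_vol (n - 1) (t - s)"
        proof -
          have "0 \<le> (1 - a) * t" "(1 - a) * t \<le> t - s"
            using s a t by (auto simp: v_def algebra_simps)
          then show ?thesis
            by (auto simp: ball_vol_def intro!: divide_right_mono mult_left_mono power_mono)
        qed
        ultimately have "c \<le> exp (\<beta> / real n * s\<^sup>2) * ball_vol (n - 1) (t - s)"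
          unfolding c_def by (intro mult_mono) (auto simp: ball_vol_nonneg)
        then have "ennreal c \<le> ennreal (exp (\<beta> / real n * s\<^sup>2)) * ennreal (ball_vol (n - 1) (t - s))"
          by (simp add: ball_vol_nonneg flip: ennreal_mult)
        then show ?thesis using True J by (simp add: g_def s_def)
      qed simp
    qed
    also have "\<dots> = (\<integral>\<^sup>+f. g (mass {0::nat} f) * indicator {..t} (mass {..<n} f) \<partial>Pi\<^sub>M {..<n} (\<lambda>_. lborel))"
      using nn_integral_mass_split[OF J(1-3) g, of t, unfolded J(4)] by simp
    also have "\<dots> \<le> (\<integral>\<^sup>+f. weight n \<beta> B f \<partial>Pi\<^sub>M {..<n} (\<lambda>_. lborel))"
    proof (rule nn_integral_mono)
      fix f :: "nat \<Rightarrow> complex"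
      have "(mass {0} f)\<^sup>2 = quartic {0} f" by (simp add: mass_def quartic_eq)
      also have "\<dots> \<le> quartic {..<n} f"
        unfolding quartic_def using n by (intro sum_mono2) auto
      finally have "ennreal (exp (\<beta> / real n * (mass {0} f)\<^sup>2))
          \<le> ennreal (exp (\<beta> / real n * quartic {..<n} f))"
        using \<beta> by (intro ennreal_leI) (auto intro!: divide_right_mono mult_left_mono)
      then show "g (mass {0} f) * indicator {..t} (mass {..<n} f) \<le> weight n \<beta> B f"
        by (simp add: g_def weight_def t_def indicator_def)
    qed
    finally show ?thesis .
  qed
qed

section \<open>The kinetic energy\<close>

text \<open>Each edge term is at most twice the masses of its endpoints, and each vertex has at most
  \<open>D\<close> neighbours. Passing to ordered pairs counts edges twice, giving the factor 4;
  symmetry of \<open>E\<close> equates the two endpoint sums.\<close>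

lemma edge_sum_le:
  assumes E: "simple_graph n E" and D: "max_degree n E = D" and n: "n > 0"
  shows "(\<Sum>(x, y)\<in>edges n E. (cmod (f x - f y))\<^sup>2) \<le> 4 * real D * mass {..<n} f"
proof -
  let ?g = "\<lambda>x. (cmod (f x))\<^sup>2"
  have deg: "degree n E x \<le> D" if "x < n" for x
    using that D n by (auto simp: max_degree_def intro!: Max_ge)
  have fin: "finite (edges n E)"
    by (rule finite_subset[of _ "{..<n} \<times> {..<n}"]) (auto simp: edges_def)
  have row: "(\<Sum>x<n. \<Sum>y<n. if E x y then ?g x else 0) \<le> real D * mass {..<n} f"
  proof -
    have "(\<Sum>y<n. if E x y then ?g x else 0) = real (degree n E x) * ?g x" for x
    proof -
      have "(\<Sum>y<n. if E x y then ?g x else 0) = (\<Sum>y\<in>{y\<in>{..<n}. E x y}. ?g x)"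
        by (rule sum.inter_filter[symmetric]) simp
      then show ?thesis by (simp add: degree_def)
    qed
    then show ?thesis
      unfolding mass_def sum_distrib_left using deg
      by (auto intro!: sum_mono mult_right_mono)
  qed
  have sq: "(cmod (w - z))\<^sup>2 \<le> 2 * (cmod w)\<^sup>2 + 2 * (cmod z)\<^sup>2" for w z
  proof -
    have "(cmod (w - z))\<^sup>2 \<le> (cmod w + cmod z)\<^sup>2"
      by (intro power_mono norm_triangle_ineq4) simp
    also have "\<dots> \<le> 2 * (cmod w)\<^sup>2 + 2 * (cmod z)\<^sup>2"
      using zero_le_power2[of "cmod w - cmod z"] by (simp add: power2_eq_square algebra_simps)
    finally show ?thesis .
  qed
  have "(\<Sum>(x, y)\<in>edges n E. (cmod (f x - f y))\<^sup>2)
      \<le> (\<Sum>(x, y)\<in>edges n E. if E x y then 2 * ?g x + 2 * ?g y else 0)"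
    by (intro sum_mono) (auto simp: edges_def sq)
  also have "\<dots> \<le> (\<Sum>(x, y)\<in>{..<n} \<times> {..<n}. if E x y then 2 * ?g x + 2 * ?g y else 0)"
    by (intro sum_mono2) (auto simp: edges_def split: if_split_asm)
  also have "\<dots> = (\<Sum>x<n. \<Sum>y<n. if E x y then 2 * ?g x + 2 * ?g y else 0)"
    by (simp add: sum.cartesian_product)
  also have "\<dots> = (\<Sum>x<n. \<Sum>y<n. 2 * (if E x y then ?g x else 0) + 2 * (if E x y then ?g y else 0))"
    by (intro sum.cong) auto
  also have "\<dots> = 2 * (\<Sum>x<n. \<Sum>y<n. if E x y then ?g x else 0)
      + 2 * (\<Sum>x<n. \<Sum>y<n. if E x y then ?g y else 0)"
    by (simp add: sum.distrib sum_distrib_left)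
  also have "(\<Sum>x<n. \<Sum>y<n. if E x y then ?g y else 0) = (\<Sum>x<n. \<Sum>y<n. if E x y then ?g x else 0)"
    using E by (subst sum.swap) (auto simp: simple_graph_def intro!: sum.cong)
  finally show ?thesis using row by simp
qed

lemma Ham_eq:
  "Ham n E h f = 2 / real n * ((\<Sum>(x, y)\<in>edges n E. (cmod (f x - f y))\<^sup>2) / h\<^sup>2)
    - 1 / real n * quartic {..<n} f"
proof -
  have "(\<Sum>(x, y)\<in>edges n E. (cmod ((f x - f y) / complex_of_real h))\<^sup>2)
      = (\<Sum>(x, y)\<in>edges n E. (cmod (f x - f y))\<^sup>2) / h\<^sup>2"
    unfolding sum_divide_distrib
    by (intro sum.cong) (auto simp: norm_divide power_divide)
  then show ?thesis by (simp add: Ham_def quartic_def)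
qed

lemma measurable_Ham: "Ham n E h \<in> borel_measurable (LebV n)"
proof -
  have [measurable]: "quartic {..<n} \<in> borel_measurable (LebV n)"
    unfolding LebV_def by (intro measurable_quartic) auto
  have [measurable]: "(\<lambda>f. \<Sum>p\<in>edges n E. (cmod (f (fst p) - f (snd p)))\<^sup>2) \<in> borel_measurable (LebV n)"
  proof (rule borel_measurable_sum)
    fix p assume "p \<in> edges n E"
    then have [measurable]: "fst p \<in> {..<n}" "snd p \<in> {..<n}" by (auto simp: edges_def)
    show "(\<lambda>f. (cmod (f (fst p) - f (snd p)))\<^sup>2) \<in> borel_measurable (LebV n)"
      unfolding LebV_def by measurable
  qed
  show ?thesis unfolding Ham_eq[abs_def] case_prod_beta by measurable
qed

text \<open>On the mass ball, \<beta> times the kinetic energy lies between 0 and a constant free of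
  \<open>n\<close>, as the prefactor \<open>2 / n\<close> cancels the mass bound
  \<open>B * n\<close>. So the partition function is the weight integral up to a bounded
  factor.\<close>

lemma ln_Zpart_bounds:
  fixes n D :: nat
  assumes E: "simple_graph n E" "max_degree n E = D" and n: "n > 0"
    and \<beta>: "\<beta> \<ge> 0" and h: "h > 0"
    and l: "ennreal (exp l) \<le> (\<integral>\<^sup>+f. weight n \<beta> B f \<partial>Pi\<^sub>M {..<n} (\<lambda>_. lborel))"
    and u: "(\<integral>\<^sup>+f. weight n \<beta> B f \<partial>Pi\<^sub>M {..<n} (\<lambda>_. lborel)) \<le> ennreal (exp u)"
  shows "l - 8 * \<beta> * real D * B / h\<^sup>2 \<le> ln (Zpart n E h \<beta> B)" "ln (Zpart n E h \<beta> B) \<le> u"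
proof -
  define \<kappa> where "\<kappa> = 8 * \<beta> * real D * B / h\<^sup>2"
  define F where "F f = exp (- \<beta> * Ham n E h f) * indicator {..B * real n} (mass {..<n} f)" for f
  have [measurable]: "mass {..<n} \<in> borel_measurable (LebV n)"
    "quartic {..<n} \<in> borel_measurable (LebV n)"
    unfolding LebV_def by (intro measurable_mass measurable_quartic order_refl)+
  note measurable_Ham [measurable]
  have Fm [measurable]: "F \<in> borel_measurable (LebV n)" unfolding F_def[abs_def] by measurable
  have Wm [measurable]: "weight n \<beta> B \<in> borel_measurable (LebV n)"
    unfolding weight_def[abs_def] by measurable
  have Z: "Zpart n E h \<beta> B = enn2real (\<integral>\<^sup>+f. ennreal (F f) \<partial>LebV n)"
  proof -
    have "Zpart n E h \<beta> B = (LINT f | LebV n. F f)"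
      unfolding Zpart_def
      by (intro Bochner_Integration.integral_cong) (auto simp: F_def Nmass_def mass_def indicator_def)
    also have "\<dots> = enn2real (\<integral>\<^sup>+f. ennreal (F f) \<partial>LebV n)"
      by (rule integral_eq_nn_integral) (auto simp: F_def)
    finally show ?thesis .
  qed
  define kin where "kin f = 2 / real n * ((\<Sum>(x, y)\<in>edges n E. (cmod (f x - f y))\<^sup>2) / h\<^sup>2)"
    for f :: "nat \<Rightarrow> complex"
  have FW: "ennreal (F f) = ennreal (exp (- (\<beta> * kin f))) * weight n \<beta> B f" for f
  proof -
    have "- \<beta> * Ham n E h f = - (\<beta> * kin f) + \<beta> / real n * quartic {..<n} f"
      unfolding Ham_eq kin_def[symmetric] by (simp add: algebra_simps)
    then show ?thesis
      by (simp add: F_def weight_def indicator_def flip: ennreal_mult exp_add)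
  qed
  have kin0: "kin f \<ge> 0" for f
    unfolding kin_def by (intro mult_nonneg_nonneg divide_nonneg_nonneg sum_nonneg) auto
  have "(\<integral>\<^sup>+f. ennreal (F f) \<partial>LebV n) \<le> (\<integral>\<^sup>+f. weight n \<beta> B f \<partial>LebV n)"
  proof (rule nn_integral_mono)
    fix f
    have "ennreal (exp (- (\<beta> * kin f))) \<le> 1" using kin0[of f] \<beta> by simp
    then show "ennreal (F f) \<le> weight n \<beta> B f"
      unfolding FW using mult_right_mono[of _ 1 "weight n \<beta> B f"] by simp
  qed
  also have "\<dots> \<le> ennreal (exp u)" using u by (simp add: LebV_def)
  finally have up: "(\<integral>\<^sup>+f. ennreal (F f) \<partial>LebV n) \<le> ennreal (exp u)" .
  have "ennreal (exp (l - \<kappa>)) = ennreal (exp (- \<kappa>)) * ennreal (exp l)"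
    by (simp flip: ennreal_mult exp_add)
  also have "\<dots> \<le> ennreal (exp (- \<kappa>)) * (\<integral>\<^sup>+f. weight n \<beta> B f \<partial>LebV n)"
    using l by (intro mult_left_mono) (auto simp: LebV_def)
  also have "\<dots> = (\<integral>\<^sup>+f. ennreal (exp (- \<kappa>)) * weight n \<beta> B f \<partial>LebV n)"
    by (simp add: nn_integral_cmult)
  also have "\<dots> \<le> (\<integral>\<^sup>+f. ennreal (F f) \<partial>LebV n)"
  proof (rule nn_integral_mono)
    fix f
    show "ennreal (exp (- \<kappa>)) * weight n \<beta> B f \<le> ennreal (F f)"
    proof (cases "mass {..<n} f \<le> B * real n")
      case True
      have "kin f \<le> 2 / real n * ((4 * real D * (B * real n)) / h\<^sup>2)"
        unfolding kin_def
      proof (intro mult_left_mono divide_right_mono)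
        show "(\<Sum>(x, y)\<in>edges n E. (cmod (f x - f y))\<^sup>2) \<le> 4 * real D * (B * real n)"
          using edge_sum_le[OF E n, of f] mult_left_mono[OF True, of "4 * real D"] by simp
      qed auto
      also have "\<dots> = 8 * real D * B / h\<^sup>2" using n by simp
      finally have "\<beta> * kin f \<le> \<kappa>" using \<beta> mult_left_mono[of "kin f" _ \<beta>] by (force simp: \<kappa>_def mult_ac)
      then show ?thesis unfolding FW by (intro mult_right_mono) (auto intro!: ennreal_leI)
    qed (simp add: weight_def)
  qed
  finally have lo: "ennreal (exp (l - \<kappa>)) \<le> (\<integral>\<^sup>+f. ennreal (F f) \<partial>LebV n)" .
  \<comment> \<open>Finiteness makes the passage through \<open>enn2real\<close> faithful; an
    infinite integral would be sent to 0.\<close>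
  have fin: "(\<integral>\<^sup>+f. ennreal (F f) \<partial>LebV n) < top" using up by (rule le_less_trans) simp
  then have eq: "(\<integral>\<^sup>+f. ennreal (F f) \<partial>LebV n) = ennreal (Zpart n E h \<beta> B)" by (simp add: Z)
  have Z1: "exp (l - \<kappa>) \<le> Zpart n E h \<beta> B"
    using lo unfolding eq by (subst (asm) ennreal_le_iff) (auto simp: Z)
  have Z2: "Zpart n E h \<beta> B \<le> exp u" using up unfolding eq by (simp add: ennreal_le_iff)
  have Zpos: "Zpart n E h \<beta> B > 0" using Z1 exp_gt_zero less_le_trans by blast
  show "l - 8 * \<beta> * real D * B / h\<^sup>2 \<le> ln (Zpart n E h \<beta> B)"
    using Z1 Zpos unfolding \<kappa>_def[symmetric] by (simp add: ln_ge_iff)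
  show "ln (Zpart n E h \<beta> B) \<le> u" using Z2 Zpos by (metis exp_le_cancel_iff exp_ln)
qed

section \<open>Choice of the set size and collection of the error terms\<close>

theorem theorem2p1:
  fixes \<beta> B \<epsilon> h :: real and D :: nat
  assumes "\<beta> \<ge> 0" and "B > 0" and "0 < \<epsilon>" and "\<epsilon> < 1 / 5" and "h > 0"
  shows "\<exists>C > 0. \<forall>(n::nat) E.
           simple_graph n E \<and> max_degree n E = D \<and> real n > C \<longrightarrow>
             ln (Zpart n E h \<beta> B) / real n - Ffree \<beta> B
               \<ge> - C * real n powr (-1/5) - C * inverse (real n * h\<^sup>2)
           \<and> ln (Zpart n E h \<beta> B) / real n - Ffree \<beta> B
               \<le> (if \<beta> * B\<^sup>2 \<le> theta_c
                   then C * real n powr (-1/5 + \<epsilon>) + C * real n powr (-4 * \<epsilon> / 5)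
                   else C * real n powr (-1/5 + \<epsilon>))"
proof -
  define \<theta> where "\<theta> = \<beta> * B\<^sup>2"
  define \<kappa> where "\<kappa> = 8 * \<beta> * real D * B / h\<^sup>2"
  \<comment> \<open>The 20 covers the numerical constants (at most 40/3) and makes \<open>n\<close>
    large enough for \<open>k < n\<close>; \<open>3 * \<theta>\<close> comes from the upper bound,
    \<kappa> from the kinetic energy.\<close>
  define C where "C = 20 + 3 * \<theta> + \<kappa>"
  have \<theta>: "\<theta> \<ge> 0" and \<kappa>: "\<kappa> \<ge> 0" using assms by (auto simp: \<theta>_def \<kappa>_def)
  have C: "C > 0" "C \<ge> 20" using \<theta> \<kappa> by (auto simp: C_def)
  \<comment> \<open>Both regimes obey the same two-sided rate \<open>n powr (-1/5)\<close>, which is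
    stronger than what is claimed.\<close>
  have main: "- C * real n powr (-1/5) \<le> ln (Zpart n E h \<beta> B) / real n - Ffree \<beta> B \<and>
      ln (Zpart n E h \<beta> B) / real n - Ffree \<beta> B \<le> C * real n powr (-1/5)"
    if E: "simple_graph n E" "max_degree n E = D" and nC: "real n > C" for n E
  proof -
    define x where "x = real n"
    have x: "x > 20" using nC C by (simp add: x_def)
    have n: "n > 20" using x by (simp add: x_def)
    \<comment> \<open>This size balances the errors \<open>k * \<theta>\<close> and
      \<open>\<theta> * n / k\<close>; the entropy cost \<open>2 * k * ln n\<close> is then of order
      \<open>sqrt n * ln n\<close>.\<close>
    define k where "k = nat \<lceil>sqrt x\<rceil>"
    have sx: "sqrt x * sqrt x = x" "sqrt x \<ge> 4" using x by (auto simp: real_le_rsqrt)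
    have k1: "sqrt x \<le> real k" "real k \<le> sqrt x + 1" using sx by (auto simp: k_def)
    have k: "0 < k" "k < n" "real k \<le> 2 * sqrt x"
    proof -
      have "4 * sqrt x \<le> x" using sx mult_right_mono[of 4 "sqrt x" "sqrt x"] by simp
      then have "real k < real n" using k1 sx x by (simp add: x_def)
      then show "k < n" by simp
      show "0 < k" using k1 sx by (cases k) auto
      show "real k \<le> 2 * sqrt x" using k1 sx by simp
    qed
    define p where "p = x powr (-1/5)"
    have F: "Ffree \<beta> B = ln B + ln pi + 1 + excess \<theta>" using Ffree_eq assms by (simp add: \<theta>_def)
    define L where "L = ln (Zpart n E h \<beta> B)"
    have low: "x * Ffree \<beta> B - 1 - ln x - 2 * \<theta> - \<kappa> \<le> L"
      and upp: "L \<le> x * Ffree \<beta> B + real k * \<theta> + \<theta> * x / real k + 2 * real k * ln x"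
      using ln_Zpart_bounds[OF E _ assms(1,5) nn_integral_weight_ge[OF assms(1,2)]
          nn_integral_weight_le[OF assms(1,2) k(1,2)]] n
      by (simp_all add: F L_def x_def \<theta>_def \<kappa>_def)
    have inv_sqrt: "sqrt x / x \<le> p" "sqrt x / x = x powr (-1/2)"
    proof -
      show e: "sqrt x / x = x powr (-1/2)"
        using x powr_diff[of x "1/2" 1] by (simp add: powr_half_sqrt)
      show "sqrt x / x \<le> p" unfolding e p_def using x by (intro powr_mono) auto
    qed
    have inv: "1 / x \<le> p"
      using x powr_mono[of "-1" "-1/5" x] by (simp add: p_def powr_minus_divide)
    \<comment> \<open>The exponent 4/5 is chosen so that division by \<open>x\<close> gives exactly
      \<open>x powr (-1/5)\<close>.\<close>
    have ln1: "ln x / x \<le> 5 / 4 * p"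
    proof -
      have "ln x / x \<le> (x powr (4/5) / (4/5)) / x"
        using x by (intro divide_right_mono ln_powr_bound) auto
      also have "\<dots> = 5 / 4 * p" using x powr_diff[of x "4/5" 1] by (simp add: p_def)
      finally show ?thesis .
    qed
    \<comment> \<open>Likewise 3/10, since \<open>-1/2 + 3/10 = -1/5\<close>.\<close>
    have ln2: "sqrt x / x * ln x \<le> 10 / 3 * p"
    proof -
      have "x powr (-1/2) * ln x \<le> x powr (-1/2) * (x powr (3/10) / (3/10))"
        using x by (intro mult_left_mono ln_powr_bound) auto
      also have "\<dots> = 10 / 3 * p" using powr_add[of x "-1/2" "3/10"] by (simp add: p_def)
      finally show ?thesis by (simp add: inv_sqrt)
    qed
    have "L / x - Ffree \<beta> B \<ge> - ((1 + 2 * \<theta> + \<kappa>) * (1 / x) + ln x / x)"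
      using divide_right_mono[OF low, of x] x by (simp add: field_simps)
    moreover have "(1 + 2 * \<theta> + \<kappa>) * (1 / x) \<le> (1 + 2 * \<theta> + \<kappa>) * p"
      using \<theta> \<kappa> inv by (intro mult_left_mono) auto
    moreover have "(1 + 2 * \<theta> + \<kappa>) * p + 5 / 4 * p \<le> C * p"
    proof -
      have "(1 + 2 * \<theta> + \<kappa>) * p + 5 / 4 * p = (1 + 2 * \<theta> + \<kappa> + 5 / 4) * p"
        by (simp add: algebra_simps)
      also have "\<dots> \<le> C * p" using \<theta> by (intro mult_right_mono) (auto simp: C_def p_def)
      finally show ?thesis .
    qed
    ultimately have lower: "L / x - Ffree \<beta> B \<ge> - C * p" using ln1 by linarith
    have "L / x - Ffree \<beta> B \<le> \<theta> * (real k / x) + \<theta> * (1 / real k) + 2 * (real k / x) * ln x"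
      using divide_right_mono[OF upp, of x] x k
      by (simp add: add_divide_distrib diff_divide_distrib mult_ac)
    also have "\<dots> \<le> \<theta> * (2 * (sqrt x / x)) + \<theta> * (sqrt x / x) + 2 * (2 * (sqrt x / x)) * ln x"
    proof -
      have "real k / x \<le> 2 * (sqrt x / x)" using k x by (simp add: divide_right_mono)
      moreover have "1 / real k \<le> sqrt x / x"
      proof -
        have "1 / real k \<le> 1 / sqrt x" using k1 sx x by (intro frac_le) auto
        also have "\<dots> = sqrt x / x" using sx x by (simp add: field_simps)
        finally show ?thesis .
      qed
      ultimately show ?thesis
        using \<theta> x by (intro add_mono mult_left_mono mult_right_mono) auto
    qed
    also have "\<dots> = 3 * \<theta> * (sqrt x / x) + 4 * (sqrt x / x * ln x)" by (simp add: algebra_simps)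
    also have "\<dots> \<le> 3 * \<theta> * p + 4 * (10 / 3 * p)"
      using \<theta> inv_sqrt ln2 by (intro add_mono mult_left_mono) auto
    also have "\<dots> \<le> C * p"
      using \<kappa> by (simp add: C_def p_def mult_right_mono algebra_simps)
    finally show ?thesis using lower by (simp add: L_def x_def p_def)
  qed
  show ?thesis
  proof (intro exI[of _ C] conjI C(1) allI impI)
    fix n :: nat and E
    assume a: "simple_graph n E \<and> max_degree n E = D \<and> real n > C"
    then have n: "real n > 1" using C by simp
    have "C * inverse (real n * h\<^sup>2) \<ge> 0" using C by simp
    then show "ln (Zpart n E h \<beta> B) / real n - Ffree \<beta> B
        \<ge> - C * real n powr (-1/5) - C * inverse (real n * h\<^sup>2)"
      using main[of n E] a by linarith
    \<comment> \<open>For \<open>n > 1\<close> and \<open>\<epsilon> > 0\<close> the stated powers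
      only enlarge the bound, and the additional error terms are nonnegative.\<close>
    have "C * real n powr (-1/5) \<le> C * real n powr (-1/5 + \<epsilon>)"
      using C n assms by (intro mult_left_mono powr_mono) auto
    moreover have "C * real n powr (-4 * \<epsilon> / 5) \<ge> 0" using C by simp
    ultimately show "ln (Zpart n E h \<beta> B) / real n - Ffree \<beta> B
        \<le> (if \<beta> * B\<^sup>2 \<le> theta_c
            then C * real n powr (-1/5 + \<epsilon>) + C * real n powr (-4 * \<epsilon> / 5)
            else C * real n powr (-1/5 + \<epsilon>))"
      using main[of n E] a by auto
  qed
qed

end
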